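(* Let $\mathbb{K}$ be any field and let $\mathcal{E}$ be a finite-dimensional regular evolution algebra over $\mathbb{K}$. Then every subalgebra $U$ of $\mathcal{E}$ admits a natural basis; that is, $U$ has a vector space basis $\{u_1,\dots,u_m\}$ such that $u_iu_j=0$ for all $i\neq j$.
   Context: An algebra over $\mathbb{K}$ is a $\mathbb{K}$-vector space with a bilinear product (not assumed associative or unital). A finite-dimensional evolution algebra over $\mathbb{K}$ is a finite-dimensional $\mathbb{K}$-algebra $\mathcal{E}$ which has a basis $B=\{e_1,\dots,e_n\}$, called a natural basis, such that $e_ie_j=0$ for all $i\neq j$. Writing $e_i^2=\sum_{j=1}^n a_{ij}e_j$, the matrix $M_B(\mathcal{E})=(a_{ij})_{i,j=1}^n$ is called the structure matrix of $\mathcal{E}$ relative to $B$. The evolution algebra $\mathcal{E}$ is regular if $\mathcal{E}=\mathcal{E}^2$ (where $\mathcal{E}^2$ is the linear span of all products), equivalently if $M_B(\mathcal{E})$ is non-singular. A subalgebra is a linear subspace closed under the product. *)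

theory Defs
  imports Complex_Main
begin

locale nonassoc_algebra = vector_space scale
  for scale :: "'a::field \<Rightarrow> 'b::ab_group_add \<Rightarrow> 'b" (infixr \<open>*s\<close> 75) +
  fixes mult :: "'b \<Rightarrow> 'b \<Rightarrow> 'b" (infixl \<open>\<odot>\<close> 70)
  assumes linear_left: "Vector_Spaces.linear scale scale (\<lambda>x. x \<odot> y)"
    and linear_right: "Vector_Spaces.linear scale scale (\<lambda>y. x \<odot> y)"
begin

definition subalgebra :: "'b set \<Rightarrow> bool" where
  "subalgebra U \<longleftrightarrow> subspace U \<and> (\<forall>x\<in>U. \<forall>y\<in>U. x \<odot> y \<in> U)"

text \<open>Natural bases are finite by definition, since all algebras considered here are
  finite-dimensional. The equation \<open>span B = U\<close> includes \<open>B \<subseteq> U\<close>.\<close>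

definition natural_basis :: "'b set \<Rightarrow> 'b set \<Rightarrow> bool" where
  "natural_basis U B \<longleftrightarrow> finite B \<and> independent B \<and> span B = U \<and>
     (\<forall>u\<in>B. \<forall>v\<in>B. u \<noteq> v \<longrightarrow> u \<odot> v = 0)"

end

locale evolution_algebra = nonassoc_algebra +
  assumes ex_natural_basis: "\<exists>B. natural_basis UNIV B"

locale regular_evolution_algebra = evolution_algebra +
  assumes regular: "span {x \<odot> y |x y. True} = UNIV"

end

theory Submission
  imports Defs
begin

text \<open>
  In coordinates with respect to a natural basis, the product is the pointwise product followed by
  the linear map \<open>e\<^sub>i \<mapsto> e\<^sub>i\<^sup>2\<close>, which is bijective by regularity. Put a basis of the subalgebra \<open>U\<close>
  in reduced echelon form: vectors \<open>u\<^sub>p\<close>, indexed by a set \<open>P\<close> of pivot coordinates, with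
  \<open>(u\<^sub>p)\<^sub>q = \<delta>\<^sub>p\<^sub>q\<close> for \<open>p, q \<in> P\<close>. With respect to the basis of the \<open>e\<^sub>i\<^sup>2\<close>, the coordinates of \<open>u\<^sub>p\<^sup>2\<close> at
  the pivots are again \<open>\<delta>\<^sub>p\<^sub>q\<close>, so the \<open>u\<^sub>p\<^sup>2\<close> are linearly independent and form another basis of \<open>U\<close>.
  For \<open>p \<noteq> q\<close> the product \<open>u\<^sub>p u\<^sub>q\<close> lies in \<open>U\<close>, hence is a combination of these squares whose
  coefficients are the coordinates of \<open>u\<^sub>p u\<^sub>q\<close> at the pivots, and those vanish. Therefore any reduced
  echelon basis of \<open>U\<close> is natural.
\<close>

context vector_space
begin

lemma independent_family:
  assumes "finite P"
    and zero: "\<forall>a. (\<Sum>p\<in>P. a p *s f p) = 0 \<longrightarrow> (\<forall>p\<in>P. a p = 0)"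
  shows "inj_on f P" and "independent (f ` P)"
proof -
  show inj: "inj_on f P"
  proof (rule inj_onI, rule ccontr)
    fix p q assume pq: "p \<in> P" "q \<in> P" "f p = f q" "p \<noteq> q"
    \<comment> \<open>These are the coefficients of the relation \<open>f p - f q = 0\<close>, which
      is nontrivial when \<open>p\<close> and \<open>q\<close> differ.\<close>
    define a where "a r = (if r = p then 1 else 0) - (if r = q then 1 else (0::'a))" for r
    have "(\<Sum>r\<in>P. a r *s f r) =
        (\<Sum>r\<in>P. (if r = p then f r else 0)) - (\<Sum>r\<in>P. (if r = q then f r else 0))"
      unfolding sum_subtractf[symmetric]
      by (rule sum.cong) (auto simp: a_def)
    also have "\<dots> = 0"
      using pq \<open>finite P\<close> by simp
    finally have "a p = 0"
      using zero pq(1) by blast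
    then show False
      using pq(4) by (simp add: a_def)
  qed
  show "independent (f ` P)"
  proof (rule independent_if_scalars_zero)
    fix g x assume "(\<Sum>x\<in>f ` P. g x *s x) = 0" and x: "x \<in> f ` P"
    then have "(\<Sum>q\<in>P. g (f q) *s f q) = 0"
      by (simp add: sum.reindex[OF inj])
    with x zero[rule_format, of "\<lambda>q. g (f q)"] show "g x = 0"
      by blast
  qed (use \<open>finite P\<close> in simp)
qed

lemma span_family:
  assumes "finite P" and "inj_on f P" and "x \<in> span (f ` P)"
  obtains a where "x = (\<Sum>p\<in>P. a p *s f p)"
proof -
  obtain g where "x = (\<Sum>v\<in>f ` P. g v *s v)"
    using assms by (auto simp: span_finite)
  then have "x = (\<Sum>p\<in>P. g (f p) *s f p)"
    by (simp add: sum.reindex[OF assms(2)])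
  then show ?thesis
    by (rule that)
qed

end

context finite_dimensional_vector_space
begin

lemma representation_Basis_sum_scale:
  "representation Basis (\<Sum>i\<in>I. a i *s v i) b = (\<Sum>i\<in>I. a i * representation Basis (v i) b)"
  by (simp add: representation_sum representation_scale independent_Basis span_Basis)

lemma eq_zero_if_representation_Basis_zero:
  assumes "\<And>b. b \<in> Basis \<Longrightarrow> representation Basis x b = 0"
  shows "x = 0"
proof -
  have "x = (\<Sum>b\<in>Basis. representation Basis x b *s b)"
    by (rule sum_representation_eq[symmetric])
       (auto simp: independent_Basis span_Basis finite_Basis)
  also have "\<dots> = 0"
    using assms by simp
  finally show ?thesis .
qed

text \<open>The pivots are a minimal set of coordinates on which no nonzero vector of \<open>U\<close> vanishes.\<close>

lemma reduced_echelon_basis: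
  assumes U: "subspace U"
  obtains P u where "P \<subseteq> Basis" and "\<And>p. p \<in> P \<Longrightarrow> u p \<in> U"
    and "\<And>p q. p \<in> P \<Longrightarrow> q \<in> P \<Longrightarrow> representation Basis (u p) q = (if p = q then 1 else 0)"
    and "inj_on u P" and "independent (u ` P)" and "span (u ` P) = U"
proof -
  let ?R = "representation Basis"
  define sep where "sep P \<longleftrightarrow> P \<subseteq> Basis \<and> (\<forall>x\<in>U. (\<forall>p\<in>P. ?R x p = 0) \<longrightarrow> x = 0)" for P
  have "sep Basis"
    using eq_zero_if_representation_Basis_zero by (auto simp: sep_def)
  then obtain P where P: "sep P" and min: "\<And>Q. sep Q \<Longrightarrow> card P \<le> card Q"
    using ex_has_least_nat[of sep Basis card] by blast
  have PB: "P \<subseteq> Basis" and sepP: "\<And>x. x \<in> U \<Longrightarrow> (\<And>p. p \<in> P \<Longrightarrow> ?R x p = 0) \<Longrightarrow> x = 0"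
    using P by (auto simp: sep_def)
  have finP: "finite P"
    using PB finite_Basis finite_subset by blast
  have "\<exists>x\<in>U. \<forall>q\<in>P. ?R x q = (if p = q then 1 else 0)" if p: "p \<in> P" for p
  proof -
    \<comment> \<open>By minimality some nonzero \<open>y\<close> in \<open>U\<close> vanishes at
      all pivots except \<open>p\<close>. It cannot vanish at \<open>p\<close> too, so it can be
      rescaled to have coordinate 1 there.\<close>
    have "\<not> sep (P - {p})"
      using min[of "P - {p}"] card_Diff1_less[OF finP p] by linarith
    then obtain y where y: "y \<in> U" "y \<noteq> 0" "\<And>q. q \<in> P \<Longrightarrow> q \<noteq> p \<Longrightarrow> ?R y q = 0"
      using PB by (auto simp: sep_def)
    then have "?R y p \<noteq> 0"
      using sepP[of y] by metis
    moreover have "?R (inverse (?R y p) *s y) q = inverse (?R y p) * ?R y q" for q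
      by (simp add: representation_scale independent_Basis span_Basis)
    ultimately show ?thesis
      using y U subspace_scale by (intro bexI[of _ "inverse (?R y p) *s y"]) auto
  qed
  then obtain u where uU: "\<And>p. p \<in> P \<Longrightarrow> u p \<in> U"
    and u: "\<And>p q. p \<in> P \<Longrightarrow> q \<in> P \<Longrightarrow> ?R (u p) q = (if p = q then 1 else 0)"
    by metis
  have coord: "?R (\<Sum>p\<in>P. a p *s u p) q = a q" if "q \<in> P" for a q
    using that finP by (simp add: representation_Basis_sum_scale u if_distrib cong: if_cong)
  have zero: "\<forall>a. (\<Sum>p\<in>P. a p *s u p) = 0 \<longrightarrow> (\<forall>p\<in>P. a p = 0)"
    using coord by (metis representation_zero)
  have "U \<subseteq> span (u ` P)"
  proof
    fix x assume x: "x \<in> U"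
    let ?y = "\<Sum>p\<in>P. ?R x p *s u p"
    \<comment> \<open>Both vectors lie in \<open>U\<close> and agree at every pivot, and the pivots
      separate \<open>U\<close>.\<close>
    have "x - ?y = 0"
    proof (rule sepP)
      show "x - ?y \<in> U"
        by (intro subspace_diff[OF U] x subspace_sum[OF U] subspace_scale[OF U] uU)
      show "?R (x - ?y) p = 0" if "p \<in> P" for p
        using that by (simp add: representation_diff independent_Basis span_Basis coord)
    qed
    moreover have "?y \<in> span (u ` P)"
      by (intro span_sum span_scale span_base imageI)
    ultimately show "x \<in> span (u ` P)"
      by simp
  qed
  moreover have "span (u ` P) \<subseteq> U"
    using uU by (intro span_minimal U) auto
  ultimately show ?thesis
    using that[OF PB uU u] independent_family[OF finP zero] by blast
qed

end

context nonassoc_algebra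
begin

sublocale mult_left: Vector_Spaces.linear scale scale "\<lambda>x. x \<odot> y" for y
  by (rule linear_left)

sublocale mult_right: Vector_Spaces.linear scale scale "\<lambda>y. x \<odot> y" for x
  by (rule linear_right)

lemma mult_natural_basis:
  assumes "natural_basis UNIV B"
  shows "x \<odot> y = (\<Sum>b\<in>B. (representation B x b * representation B y b) *s (b \<odot> b))"
proof -
  let ?R = "representation B"
  have B: "finite B" "independent B" "span B = UNIV"
    and orth: "\<And>b c. b \<in> B \<Longrightarrow> c \<in> B \<Longrightarrow> b \<noteq> c \<Longrightarrow> b \<odot> c = 0"
    using assms by (auto simp: natural_basis_def)
  have repr: "(\<Sum>b\<in>B. ?R z b *s b) = z" for z
    by (rule sum_representation_eq) (use B in auto)
  have "x \<odot> y = (\<Sum>b\<in>B. ?R x b *s b) \<odot> (\<Sum>c\<in>B. ?R y c *s c)"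
    by (simp only: repr)
  also have "\<dots> = (\<Sum>b\<in>B. \<Sum>c\<in>B. ?R x b *s (?R y c *s (b \<odot> c)))"
    by (subst sum.swap)
       (simp add: mult_left.sum mult_left.scale mult_right.sum mult_right.scale scale_sum_right mult.commute)
  also have "\<dots> = (\<Sum>b\<in>B. \<Sum>c\<in>B. if c = b then (?R x b * ?R y b) *s (b \<odot> b) else 0)"
    by (intro sum.cong refl) (auto simp: orth)
  finally show ?thesis
    using B(1) by simp
qed

end

context regular_evolution_algebra
begin

text \<open>Every product is a combination of squares, so by regularity the squares span. Since
  there are at most \<open>card B\<close> of them, which is the dimension, they are independent and
  pairwise distinct.\<close>

lemma squares_natural_basis:
  assumes nat: "natural_basis UNIV B"
  shows "inj_on (\<lambda>b. b \<odot> b) B" and "independent ((\<lambda>b. b \<odot> b) ` B)"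
    and "span ((\<lambda>b. b \<odot> b) ` B) = UNIV"
proof -
  let ?S = "(\<lambda>b. b \<odot> b) ` B"
  have B: "finite B" "independent B" "span B = UNIV"
    using nat by (auto simp: natural_basis_def)
  interpret finite_dimensional_vector_space scale B
    by unfold_locales (use B in auto)
  have "x \<odot> y \<in> span ?S" for x y
    unfolding mult_natural_basis[OF nat, of x y]
    by (intro span_sum span_scale span_base imageI)
  then have "span {x \<odot> y |x y. True} \<subseteq> span ?S"
    by (intro span_minimal) auto
  then show sp: "span ?S = UNIV"
    using regular by blast
  show ind: "independent ?S"
    by (rule card_le_dim_spanning[of _ UNIV]) (use sp B(1) card_image_le in auto)
  have "card ?S = card B"
    using dim_eq_card[of ?S UNIV] sp ind by simp
  then show "inj_on (\<lambda>b. b \<odot> b) B"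
    using B(1) eq_card_imp_inj_on by blast
qed

text \<open>The expansion in \<open>mult_natural_basis\<close> is already written in the basis of
  squares; injectivity of squaring on \<open>B\<close> lets its coefficients be read off.\<close>

lemma representation_squares_mult:
  assumes nat: "natural_basis UNIV B" and b: "b \<in> B"
  shows "representation ((\<lambda>b. b \<odot> b) ` B) (x \<odot> y) (b \<odot> b) =
    representation B x b * representation B y b"
proof -
  let ?S = "(\<lambda>b. b \<odot> b) ` B"
  note S = squares_natural_basis[OF nat]
  have "finite B"
    using nat by (simp add: natural_basis_def)
  have "representation ?S (x \<odot> y) (b \<odot> b) =
      (\<Sum>c\<in>B. representation B x c * representation B y c * representation ?S (c \<odot> c) (b \<odot> b))"
    unfolding mult_natural_basis[OF nat, of x y]
    by (simp add: representation_sum representation_scale S)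
  also have "\<dots> = (\<Sum>c\<in>B. if c = b then representation B x b * representation B y b else 0)"
    using S(1) b by (intro sum.cong refl) (auto simp: representation_basis[OF S(2)] inj_on_def)
  finally show ?thesis
    using \<open>finite B\<close> b by simp
qed

theorem subalgebra_has_natural_basis:
  assumes "subalgebra U"
  shows "\<exists>C. natural_basis U C"
proof -
  have U: "subspace U" and closed: "\<And>x y. x \<in> U \<Longrightarrow> y \<in> U \<Longrightarrow> x \<odot> y \<in> U"
    using assms by (auto simp: subalgebra_def)
  obtain B where nat: "natural_basis UNIV B"
    using ex_natural_basis by blast
  \<comment> \<open>With \<open>B\<close> as the locale's \<open>Basis\<close>, the echelon form
    below refers to natural coordinates.\<close>
  then interpret finite_dimensional_vector_space scale B
    by unfold_locales (auto simp: natural_basis_def)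
  let ?S = "(\<lambda>b. b \<odot> b) ` B"
  note S = squares_natural_basis[OF nat]
  obtain P u where PB: "P \<subseteq> B" and uU: "\<And>p. p \<in> P \<Longrightarrow> u p \<in> U"
    and u: "\<And>p q. p \<in> P \<Longrightarrow> q \<in> P \<Longrightarrow> representation B (u p) q = (if p = q then 1 else 0)"
    and inj_u: "inj_on u P" and ind_u: "independent (u ` P)" and span_u: "span (u ` P) = U"
    using reduced_echelon_basis[OF U] by blast
  have finP: "finite P"
    using PB finite_Basis finite_subset by blast
  let ?sq = "\<lambda>p. u p \<odot> u p"
  \<comment> \<open>At a pivot, \<open>?sq p\<close> has the squared coordinate of
    \<open>u p\<close>, and 0 and 1 are their own squares.\<close>
  have coord: "representation ?S (\<Sum>p\<in>P. a p *s ?sq p) (q \<odot> q) = a q" if q: "q \<in> P" for a q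
  proof -
    have "representation ?S (\<Sum>p\<in>P. a p *s ?sq p) (q \<odot> q) =
        (\<Sum>p\<in>P. a p * (representation B (u p) q * representation B (u p) q))"
      using q PB by (simp add: representation_sum representation_scale S
          representation_squares_mult[OF nat] subset_iff)
    also have "\<dots> = (\<Sum>p\<in>P. if p = q then a q else 0)"
      using q by (intro sum.cong refl) (auto simp: u)
    finally show ?thesis
      using finP q by simp
  qed
  have zero: "\<forall>a. (\<Sum>p\<in>P. a p *s ?sq p) = 0 \<longrightarrow> (\<forall>p\<in>P. a p = 0)"
    using coord by (metis representation_zero)
  note sq = independent_family[OF finP zero]
  have "dim U = card P"
    using dim_span_eq_card_independent[OF ind_u] span_u card_image[OF inj_u] by simp
  \<comment> \<open>The squares are \<open>dim U\<close> independent vectors inside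
    \<open>U\<close>.\<close>
  then have U_sq: "U \<subseteq> span (?sq ` P)"
    by (intro card_ge_dim_independent sq(2)) (auto simp: closed uU card_image[OF sq(1)])
  have "u p \<odot> u q = 0" if p: "p \<in> P" and q: "q \<in> P" and "p \<noteq> q" for p q
  proof -
    have "u p \<odot> u q \<in> span (?sq ` P)"
      using U_sq closed uU p q by blast
    then obtain a where a: "u p \<odot> u q = (\<Sum>r\<in>P. a r *s ?sq r)"
      by (rule span_family[OF finP sq(1)])
    have "a r = 0" if r: "r \<in> P" for r
    proof -
      \<comment> \<open>One factor is 0, because \<open>r\<close> cannot equal both \<open>p\<close>
        and \<open>q\<close>.\<close>
      have "a r = representation B (u p) r * representation B (u q) r"
        using coord[OF r, of a] representation_squares_mult[OF nat, of r "u p" "u q"] r PB a by auto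
      then show ?thesis
        using u p q r \<open>p \<noteq> q\<close> by auto
    qed
    then show ?thesis
      using a by simp
  qed
  then have "natural_basis U (u ` P)"
    using finP ind_u span_u by (auto simp: natural_basis_def)
  then show ?thesis ..
qed

end

theorem theorem2:
  fixes scale :: "'a::field \<Rightarrow> 'b::ab_group_add \<Rightarrow> 'b"
    and mult :: "'b \<Rightarrow> 'b \<Rightarrow> 'b"
    and U :: "'b set"
  assumes "regular_evolution_algebra scale mult"
    and "nonassoc_algebra.subalgebra scale mult U"
  shows "\<exists>B. nonassoc_algebra.natural_basis scale mult U B"
  using regular_evolution_algebra.subalgebra_has_natural_basis[OF assms] .

end
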